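(* Let $(M,\Delta_\diamond,\Delta_\bullet,\alpha_M)$ be a comodule over the post-Hom-Lie coalgebra $(L,\gamma,\Delta_\cdot,\alpha)$. For any non-negative integer $k$, define $$\Delta_\diamond^{0,k}=\Delta_\diamond\circ\alpha_M^{2^k-1}:M\to L\otimes M,\qquad \Delta_\bullet^{0,k}=\Delta_\bullet\circ\alpha_M^{2^k-1}:M\to L\otimes M .$$ Then $(M,\Delta_\diamond^{0,k},\Delta_\bullet^{0,k},\alpha_M^{2^k})$ is a comodule over $(L,\gamma\circ\alpha^{2^k-1},\Delta_\cdot\circ\alpha^{2^k-1},\alpha^{2^k})$.
   Context: All vector spaces are over a field $\mathbb{F}$ of characteristic $0$; $I$ is the identity map, $\tau(x\otimes y)=y\otimes x$, $\xi(x\otimes y\otimes z)=y\otimes z\otimes x$, $\xi^2(x\otimes y\otimes z)=z\otimes x\otimes y$. A post-Hom-Lie coalgebra $(L,\gamma,\Delta_\cdot,\alpha)$ is a vector space $L$ with linear maps $\gamma,\Delta_\cdot:L\to L\otimes L$ and $\alpha:L\to L$ such that (i) $\gamma=-\tau\circ\gamma$ and $\gamma\circ\alpha=(\alpha\otimes\alpha)\circ\gamma$; (ii) $(1+\xi+\xi^2)\circ(\alpha\otimes\gamma)\circ\gamma=0$; (iii) $(\alpha\otimes\gamma)\circ\Delta_\cdot-(\Delta_\cdot\otimes\alpha)\circ\gamma-(\tau\otimes I)\circ(\alpha\otimes\Delta_\cdot)\circ\gamma=0$; (iv) $(\Delta_\cdot\otimes\alpha)\circ\Delta_\cdot-(\alpha\otimes\Delta_\cdot)\circ\Delta_\cdot-(\tau\otimes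 I)\circ(\Delta_\cdot\otimes\alpha)\circ\Delta_\cdot+(\tau\otimes I)\circ(\alpha\otimes\Delta_\cdot)\circ\Delta_\cdot+(\gamma\otimes\alpha)\circ\Delta_\cdot=0$. A comodule over $(L,\gamma,\Delta_\cdot,\alpha)$ is a tuple $(M,\Delta_\diamond,\Delta_\bullet,\alpha_M)$ with $M$ a vector space, $\alpha_M:M\to M$ linear, and linear maps $\Delta_\diamond,\Delta_\bullet:M\to L\otimes M$ such that (a) $\Delta_\diamond\circ\alpha_M=(\alpha\otimes\alpha_M)\circ\Delta_\diamond$ and $\Delta_\bullet\circ\alpha_M=(\alpha\otimes\alpha_M)\circ\Delta_\bullet$; (b) $(\gamma\otimes\alpha_M)\circ\Delta_\diamond=(\alpha\otimes\Delta_\diamond)\circ\Delta_\diamond-(\tau\otimes \mathrm{Id}_M)\circ(\alpha\otimes\Delta_\diamond)\circ\Delta_\diamond$; (c) $(\Delta_\cdot\otimes\alpha_M)\circ\Delta_\diamond=(\alpha\otimes\Delta_\diamond)\circ\Delta_\bullet-(\tau\otimes \mathrm{Id}_M)\circ(\alpha\otimes\Delta_\bullet)\circ\Delta_\diamond$; (d) $(\gamma\otimes\alpha_M)\circ\Delta_\bullet=(1-\tau\otimes \mathrm{Id}_M)\circ(\alpha\otimes\Delta_\bullet)\circ\Delta_\bullet+(\tau\otimes \mathrm{Id}_M-1)\circ(\Delta_\cdot\otimes\alpha_M)\circ\Delta_\bullet$.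
   Formalization: "Is a comodule over" the twisted tuple is read as linearity and conditions (a)–(d) only; that the twisted tuple on L is again a post-Hom-Lie coalgebra is not asserted, since it can fail when Δ_· does not commute with α. *)

theory Defs
  imports "Jordan_Normal_Form.Missing_VectorSpace" "HOL-Algebra.AbelCoset"
begin

section \<open>Quotients of modules\<close>

text \<open>
  The \<open>mult\<close> and \<open>one\<close> fields of the records below are dummies: a record of type \<open>module\<close>
  inherits them from \<open>ring\<close>, but the locales \<open>module\<close> and \<open>vectorspace\<close> do not constrain them.
\<close>

definition quotient_module :: "('r, 'v, 'm) module_scheme \<Rightarrow> 'v set \<Rightarrow> ('r, 'v set) module"
  where "quotient_module V N =
    \<lparr>carrier = a_rcosets\<^bsub>V\<^esub> N, mult = (\<lambda>_ _. N), one = N, zero = N,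
     add = (\<lambda>X Y. X <+>\<^bsub>V\<^esub> Y),
     smult = (\<lambda>r X. \<Union>x\<in>X. N +>\<^bsub>V\<^esub> (r \<odot>\<^bsub>V\<^esub> x))\<rparr>"

lemma quotient_module_facts:
  assumes "module R V" and N: "submodule R N V"
  shows "module R (quotient_module V N)"
    and "(\<lambda>x. N +>\<^bsub>V\<^esub> x) \<in> module_hom R V (quotient_module V N)"
    and "carrier (quotient_module V N) = (\<lambda>x. N +>\<^bsub>V\<^esub> x) ` carrier V"
    and "\<And>x. x \<in> N \<Longrightarrow> N +>\<^bsub>V\<^esub> x = \<zero>\<^bsub>quotient_module V N\<^esub>"
proof -
  interpret V: module R V by fact
  interpret N: submodule R N V by fact
  have sub: "subgroup N (add_monoid V)"
  proof (rule V.add.subgroupI)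
    show "N \<subseteq> carrier V" by (rule N.subset)
    show "N \<noteq> {}" using N.zero_closed by blast
    show "\<ominus>\<^bsub>V\<^esub> a \<in> N" if "a \<in> N" for a
    proof -
      have "a \<in> carrier V" using that N.subset by auto
      then have "\<ominus>\<^bsub>V\<^esub> a = (\<ominus>\<^bsub>R\<^esub> \<one>\<^bsub>R\<^esub>) \<odot>\<^bsub>V\<^esub> a" by (simp add: V.smult_minus_1)
      then show ?thesis using N.smult_closed[of "\<ominus>\<^bsub>R\<^esub> \<one>\<^bsub>R\<^esub>" a] that by simp
    qed
  qed auto
  interpret A: abelian_subgroup N V
    using sub by (intro abelian_subgroupI3 additive_subgroup.intro V.abelian_group_axioms)
  have car: "carrier (quotient_module V N) = (\<lambda>x. N +>\<^bsub>V\<^esub> x) ` carrier V"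
    by (auto simp: quotient_module_def A_RCOSETS_def' )
  have add: "(N +>\<^bsub>V\<^esub> x) \<oplus>\<^bsub>quotient_module V N\<^esub> (N +>\<^bsub>V\<^esub> y) = N +>\<^bsub>V\<^esub> (x \<oplus>\<^bsub>V\<^esub> y)"
    if "x \<in> carrier V" "y \<in> carrier V" for x y
    using that by (simp add: quotient_module_def A.a_rcos_sum)
  have sm: "r \<odot>\<^bsub>quotient_module V N\<^esub> (N +>\<^bsub>V\<^esub> x) = N +>\<^bsub>V\<^esub> (r \<odot>\<^bsub>V\<^esub> x)"
    if r: "r \<in> carrier R" and x: "x \<in> carrier V" for r x
  proof -
    have "N +>\<^bsub>V\<^esub> (r \<odot>\<^bsub>V\<^esub> y) = N +>\<^bsub>V\<^esub> (r \<odot>\<^bsub>V\<^esub> x)" if y: "y \<in> N +>\<^bsub>V\<^esub> x" for y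
    proof -
      from y obtain n where n: "n \<in> N" "y = n \<oplus>\<^bsub>V\<^esub> x" by (auto simp: a_r_coset_def')
      have nc: "n \<in> carrier V" using n N.subset by auto
      have "r \<odot>\<^bsub>V\<^esub> y = r \<odot>\<^bsub>V\<^esub> n \<oplus>\<^bsub>V\<^esub> r \<odot>\<^bsub>V\<^esub> x"
        using n(2) nc r x by (simp add: V.smult_r_distr)
      moreover have "r \<odot>\<^bsub>V\<^esub> n \<in> N" using n r by simp
      ultimately have "r \<odot>\<^bsub>V\<^esub> y \<in> N +>\<^bsub>V\<^esub> (r \<odot>\<^bsub>V\<^esub> x)" by (auto simp: a_r_coset_def')
      then show ?thesis
        using V.a_repr_independence[of "r \<odot>\<^bsub>V\<^esub> y" N "r \<odot>\<^bsub>V\<^esub> x"] r x sub by simp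
    qed
    moreover have "x \<in> N +>\<^bsub>V\<^esub> x" using A.a_rcos_self[OF x] .
    ultimately have "(\<Union>y\<in>N +>\<^bsub>V\<^esub> x. N +>\<^bsub>V\<^esub> (r \<odot>\<^bsub>V\<^esub> y)) = N +>\<^bsub>V\<^esub> (r \<odot>\<^bsub>V\<^esub> x)" by blast
    then show ?thesis by (simp only: quotient_module_def module.simps)
  qed
  have zero: "\<zero>\<^bsub>quotient_module V N\<^esub> = N +>\<^bsub>V\<^esub> \<zero>\<^bsub>V\<^esub>"
    by (simp add: quotient_module_def N.subset)
  show "module R (quotient_module V N)"
  proof (rule module_criteria)
    show "cring R" ..
    show "\<forall>v\<in>carrier (quotient_module V N). \<exists>neg_v\<in>carrier (quotient_module V N).
        v \<oplus>\<^bsub>quotient_module V N\<^esub> neg_v = \<zero>\<^bsub>quotient_module V N\<^esub>"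
    proof
      fix v assume "v \<in> carrier (quotient_module V N)"
      then obtain x where x: "x \<in> carrier V" "v = N +>\<^bsub>V\<^esub> x" by (auto simp: car)
      show "\<exists>w\<in>carrier (quotient_module V N).
          v \<oplus>\<^bsub>quotient_module V N\<^esub> w = \<zero>\<^bsub>quotient_module V N\<^esub>"
        by (rule bexI[of _ "N +>\<^bsub>V\<^esub> (\<ominus>\<^bsub>V\<^esub> x)"]) (use x in \<open>auto simp: car add zero V.r_neg\<close>)
    qed
    let ?Q = "quotient_module V N"
    show "\<zero>\<^bsub>?Q\<^esub> \<in> carrier ?Q"
      unfolding car zero by (rule imageI) (rule V.zero_closed)
    show "\<forall>v w. v \<in> carrier ?Q \<and> w \<in> carrier ?Q \<longrightarrow> v \<oplus>\<^bsub>?Q\<^esub> w \<in> carrier ?Q"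
      using add by (auto simp: car)
    show "\<forall>c v. c \<in> carrier R \<and> v \<in> carrier ?Q \<longrightarrow> c \<odot>\<^bsub>?Q\<^esub> v \<in> carrier ?Q"
      using sm by (auto simp: car)
    show "\<forall>v w. v \<in> carrier ?Q \<and> w \<in> carrier ?Q \<longrightarrow> v \<oplus>\<^bsub>?Q\<^esub> w = w \<oplus>\<^bsub>?Q\<^esub> v"
      using add V.a_comm by (auto simp: car)
    show "\<forall>v w x. v \<in> carrier ?Q \<and> w \<in> carrier ?Q \<and> x \<in> carrier ?Q \<longrightarrow>
        (v \<oplus>\<^bsub>?Q\<^esub> w) \<oplus>\<^bsub>?Q\<^esub> x = v \<oplus>\<^bsub>?Q\<^esub> (w \<oplus>\<^bsub>?Q\<^esub> x)"
      using V.a_assoc by (auto simp: car add)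
  qed (auto simp: car add sm zero V.smult_l_distr V.smult_r_distr V.smult_assoc1)
  show "(\<lambda>x. N +>\<^bsub>V\<^esub> x) \<in> module_hom R V (quotient_module V N)"
    by (auto simp: module_hom_def car add sm)
  show "carrier (quotient_module V N) = (\<lambda>x. N +>\<^bsub>V\<^esub> x) ` carrier V"
    by (rule car)
  show "N +>\<^bsub>V\<^esub> x = \<zero>\<^bsub>quotient_module V N\<^esub>" if "x \<in> N" for x
    using V.a_coset_join2[OF _ sub that] that N.subset by (auto simp: quotient_module_def)
qed


section \<open>Tensor products\<close>

definition free_module :: "('r, 'm) ring_scheme \<Rightarrow> 'x set \<Rightarrow> ('r, 'x \<Rightarrow> 'r) module"
  where "free_module R X =
    \<lparr>carrier = {h. (\<forall>x. h x \<in> carrier R) \<and> {x. h x \<noteq> \<zero>\<^bsub>R\<^esub>} \<subseteq> X \<and> finite {x. h x \<noteq> \<zero>\<^bsub>R\<^esub>}},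
     mult = (\<lambda>_ _ _. \<zero>\<^bsub>R\<^esub>), one = (\<lambda>_. \<zero>\<^bsub>R\<^esub>), zero = (\<lambda>_. \<zero>\<^bsub>R\<^esub>),
     add = (\<lambda>h k x. h x \<oplus>\<^bsub>R\<^esub> k x),
     smult = (\<lambda>r h x. r \<otimes>\<^bsub>R\<^esub> h x)\<rparr>"

definition free_gen :: "('r, 'm) ring_scheme \<Rightarrow> 'x \<Rightarrow> 'x \<Rightarrow> 'r"
  where "free_gen R x = (\<lambda>y. if y = x then \<one>\<^bsub>R\<^esub> else \<zero>\<^bsub>R\<^esub>)"

lemma free_module_module:
  assumes "cring R"
  shows "module R (free_module R X)"
proof -
  interpret cring R by fact
  have fin_add: "finite {x. h x \<oplus>\<^bsub>R\<^esub> k x \<noteq> \<zero>\<^bsub>R\<^esub>}"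
    if "finite {x. h x \<noteq> \<zero>\<^bsub>R\<^esub>}" "finite {x. k x \<noteq> \<zero>\<^bsub>R\<^esub>}" for h k
    by (rule finite_subset[OF _ finite_UnI[OF that]]) auto
  have fin_smult: "finite {x. r \<otimes>\<^bsub>R\<^esub> h x \<noteq> \<zero>\<^bsub>R\<^esub>}"
    if "finite {x. h x \<noteq> \<zero>\<^bsub>R\<^esub>}" "r \<in> carrier R" for r h
    by (rule finite_subset[OF _ that(1)]) (use that(2) in auto)
  show ?thesis
  proof (rule module_criteria)
    show "\<forall>v\<in>carrier (free_module R X). \<exists>neg_v\<in>carrier (free_module R X).
        v \<oplus>\<^bsub>free_module R X\<^esub> neg_v = \<zero>\<^bsub>free_module R X\<^esub>"
    proof
      fix v assume v: "v \<in> carrier (free_module R X)"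
      then have vc: "v x \<in> carrier R" for x by (simp add: free_module_def)
      then have "{x. \<ominus>\<^bsub>R\<^esub> v x \<noteq> \<zero>\<^bsub>R\<^esub>} = {x. v x \<noteq> \<zero>\<^bsub>R\<^esub>}"
        by (metis minus_zero minus_minus)
      then show "\<exists>w\<in>carrier (free_module R X).
          v \<oplus>\<^bsub>free_module R X\<^esub> w = \<zero>\<^bsub>free_module R X\<^esub>"
        by (intro bexI[of _ "\<lambda>x. \<ominus>\<^bsub>R\<^esub> v x"]) (use v in \<open>auto simp: free_module_def r_neg\<close>)
    qed
    show "\<forall>v w. v \<in> carrier (free_module R X) \<and> w \<in> carrier (free_module R X) \<longrightarrow>
        v \<oplus>\<^bsub>free_module R X\<^esub> w \<in> carrier (free_module R X)"
    proof (intro allI impI, elim conjE)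
      fix v w assume vw: "v \<in> carrier (free_module R X)" "w \<in> carrier (free_module R X)"
      then have "{x. v x \<oplus>\<^bsub>R\<^esub> w x \<noteq> \<zero>\<^bsub>R\<^esub>} \<subseteq> {x. v x \<noteq> \<zero>\<^bsub>R\<^esub>} \<union> {x. w x \<noteq> \<zero>\<^bsub>R\<^esub>}" by auto
      also have "\<dots> \<subseteq> X" using vw by (auto simp: free_module_def)
      finally show "v \<oplus>\<^bsub>free_module R X\<^esub> w \<in> carrier (free_module R X)"
        using vw fin_add[of v w] by (simp add: free_module_def)
    qed
    show "\<forall>c v. c \<in> carrier R \<and> v \<in> carrier (free_module R X) \<longrightarrow>
        c \<odot>\<^bsub>free_module R X\<^esub> v \<in> carrier (free_module R X)"
      by (auto simp: free_module_def fin_smult)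
    show "\<forall>v w. v \<in> carrier (free_module R X) \<and> w \<in> carrier (free_module R X) \<longrightarrow>
        v \<oplus>\<^bsub>free_module R X\<^esub> w = w \<oplus>\<^bsub>free_module R X\<^esub> v"
      by (simp add: free_module_def fun_eq_iff a_comm)
  qed (simp_all add: free_module_def l_distr r_distr m_assoc a_assoc is_cring)
qed

lemma free_gen_closed:
  assumes "cring R" "x \<in> X"
  shows "free_gen R x \<in> carrier (free_module R X)"
proof -
  interpret cring R by fact
  have "finite {y. free_gen R x y \<noteq> \<zero>\<^bsub>R\<^esub>}"
    by (rule finite_subset[of _ "{x}"]) (auto simp: free_gen_def)
  then show ?thesis using assms(2) by (auto simp: free_module_def free_gen_def)
qed

lemma free_module_ext:
  assumes "module R T" and \<beta>: "\<And>x. x \<in> X \<Longrightarrow> \<beta> x \<in> carrier T"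
  obtains \<phi> where "\<phi> \<in> module_hom R (free_module R X) T"
    and "\<And>x. x \<in> X \<Longrightarrow> \<phi> (free_gen R x) = \<beta> x"
proof -
  interpret T: module R T by fact
  define \<phi> where "\<phi> h = (\<Oplus>\<^bsub>T\<^esub>x\<in>{x. h x \<noteq> \<zero>\<^bsub>R\<^esub>}. h x \<odot>\<^bsub>T\<^esub> \<beta> x)" for h
  have \<phi>: "\<phi> h = (\<Oplus>\<^bsub>T\<^esub>x\<in>S. h x \<odot>\<^bsub>T\<^esub> \<beta> x)"
    if "finite S" "S \<subseteq> X" "{x. h x \<noteq> \<zero>\<^bsub>R\<^esub>} \<subseteq> S" "\<And>x. h x \<in> carrier R" for S h
    unfolding \<phi>_def using that \<beta>
    by (intro T.add.finprod_mono_neutral_cong_left) (auto simp: subset_iff)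
  have "\<phi> \<in> module_hom R (free_module R X) T"
    unfolding module_hom_def
  proof (safe)
    fix h assume "h \<in> carrier (free_module R X)"
    then show "\<phi> h \<in> carrier T"
      unfolding \<phi>_def by (intro T.finsum_closed) (auto simp: free_module_def intro!: \<beta>)
  next
    fix h k assume hk: "h \<in> carrier (free_module R X)" "k \<in> carrier (free_module R X)"
    let ?S = "{x. h x \<noteq> \<zero>\<^bsub>R\<^esub>} \<union> {x. k x \<noteq> \<zero>\<^bsub>R\<^esub>}"
    have S: "finite ?S" "?S \<subseteq> X" using hk by (auto simp: free_module_def)
    have c: "h x \<in> carrier R" "k x \<in> carrier R" for x using hk by (auto simp: free_module_def)
    have "\<phi> (h \<oplus>\<^bsub>free_module R X\<^esub> k) = (\<Oplus>\<^bsub>T\<^esub>x\<in>?S. (h x \<oplus>\<^bsub>R\<^esub> k x) \<odot>\<^bsub>T\<^esub> \<beta> x)"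
      by (subst \<phi>[OF S]) (use c in \<open>auto simp: free_module_def\<close>)
    also have "\<dots> = (\<Oplus>\<^bsub>T\<^esub>x\<in>?S. h x \<odot>\<^bsub>T\<^esub> \<beta> x \<oplus>\<^bsub>T\<^esub> k x \<odot>\<^bsub>T\<^esub> \<beta> x)"
      by (intro T.finsum_cong') (use c S \<beta> in \<open>auto simp: T.smult_l_distr subset_iff\<close>)
    also have "\<dots> = (\<Oplus>\<^bsub>T\<^esub>x\<in>?S. h x \<odot>\<^bsub>T\<^esub> \<beta> x) \<oplus>\<^bsub>T\<^esub> (\<Oplus>\<^bsub>T\<^esub>x\<in>?S. k x \<odot>\<^bsub>T\<^esub> \<beta> x)"
      by (intro T.finsum_addf) (use c S \<beta> in \<open>auto simp: subset_iff\<close>)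
    also have "\<dots> = \<phi> h \<oplus>\<^bsub>T\<^esub> \<phi> k"
      by (subst (1 2) \<phi>[OF S]) (use c in auto)
    finally show "\<phi> (h \<oplus>\<^bsub>free_module R X\<^esub> k) = \<phi> h \<oplus>\<^bsub>T\<^esub> \<phi> k" .
  next
    fix r h assume r: "r \<in> carrier R" and h: "h \<in> carrier (free_module R X)"
    let ?S = "{x. h x \<noteq> \<zero>\<^bsub>R\<^esub>}"
    have S: "finite ?S" "?S \<subseteq> X" using h by (auto simp: free_module_def)
    have c: "h x \<in> carrier R" for x using h by (auto simp: free_module_def)
    have "\<phi> (r \<odot>\<^bsub>free_module R X\<^esub> h) = (\<Oplus>\<^bsub>T\<^esub>x\<in>?S. (r \<otimes>\<^bsub>R\<^esub> h x) \<odot>\<^bsub>T\<^esub> \<beta> x)"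
      by (subst \<phi>[OF S]) (use c r in \<open>auto simp: free_module_def\<close>)
    also have "\<dots> = (\<Oplus>\<^bsub>T\<^esub>x\<in>?S. r \<odot>\<^bsub>T\<^esub> (h x \<odot>\<^bsub>T\<^esub> \<beta> x))"
      by (intro T.finsum_cong') (use c r S \<beta> in \<open>auto simp: T.smult_assoc1 subset_iff\<close>)
    also have "\<dots> = r \<odot>\<^bsub>T\<^esub> \<phi> h"
      unfolding \<phi>_def
      by (intro T.finsum_smult_ldistr[symmetric]) (use c r S \<beta> in \<open>auto simp: subset_iff\<close>)
    finally show "\<phi> (r \<odot>\<^bsub>free_module R X\<^esub> h) = r \<odot>\<^bsub>T\<^esub> \<phi> h" .
  qed
  moreover have "\<phi> (free_gen R x) = \<beta> x" if x: "x \<in> X" for x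
    by (subst \<phi>[of "{x}"]) (use x \<beta> in \<open>auto simp: free_gen_def\<close>)
  ultimately show ?thesis using that by blast
qed

lemma free_module_hom_eqI:
  assumes "module R T" and \<phi>: "\<phi> \<in> module_hom R (free_module R X) T"
    and \<psi>: "\<psi> \<in> module_hom R (free_module R X) T"
    and eq: "\<And>x. x \<in> X \<Longrightarrow> \<phi> (free_gen R x) = \<psi> (free_gen R x)"
    and h: "h \<in> carrier (free_module R X)"
  shows "\<phi> h = \<psi> h"
proof -
  interpret T: module R T by fact
  interpret V: module R "free_module R X" by (rule free_module_module) (rule T.is_cring)
  interpret \<phi>: mod_hom R "free_module R X" T \<phi> by unfold_locales (rule \<phi>)
  interpret \<psi>: mod_hom R "free_module R X" T \<psi> by unfold_locales (rule \<psi>)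
  have "finite {x. h x \<noteq> \<zero>\<^bsub>R\<^esub>}" using h by (auto simp: free_module_def)
  then show ?thesis
    using h
  proof (induction "{x. h x \<noteq> \<zero>\<^bsub>R\<^esub>}" arbitrary: h rule: finite_psubset_induct)
    case (psubset h)
    show ?case
    proof (cases "{x. h x \<noteq> \<zero>\<^bsub>R\<^esub>} = {}")
      case True
      then have "h = \<zero>\<^bsub>free_module R X\<^esub>" by (auto simp: free_module_def)
      then show ?thesis by simp
    next
      case False
      then obtain x where hx: "h x \<noteq> \<zero>\<^bsub>R\<^esub>" by auto
      have c: "h y \<in> carrier R" for y using psubset.prems by (auto simp: free_module_def)
      have x: "x \<in> X" using psubset.prems hx by (auto simp: free_module_def)
      define k where "k = h(x := \<zero>\<^bsub>R\<^esub>)"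
      have kc: "k \<in> carrier (free_module R X)"
        using psubset.prems
        by (auto simp: k_def free_module_def elim!: rev_finite_subset)
      have "{y. k y \<noteq> \<zero>\<^bsub>R\<^esub>} \<subset> {y. h y \<noteq> \<zero>\<^bsub>R\<^esub>}" using hx by (auto simp: k_def)
      then have IH: "\<phi> k = \<psi> k" using psubset.hyps kc by blast
      have "h = k \<oplus>\<^bsub>free_module R X\<^esub> (h x \<odot>\<^bsub>free_module R X\<^esub> free_gen R x)"
        using c by (auto simp: k_def free_module_def free_gen_def)
      moreover have "free_gen R x \<in> carrier (free_module R X)"
        using x T.is_cring by (rule free_gen_closed[rotated])
      ultimately show ?thesis
        using IH eq[OF x] kc c by (metis V.smult_closed \<phi>.f_add \<phi>.f_smult \<psi>.f_add \<psi>.f_smult)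
    qed
  qed
qed

definition tensor_relations ::
    "('r, 'm) ring_scheme \<Rightarrow> ('r, 'a, 'm1) module_scheme \<Rightarrow> ('r, 'b, 'm2) module_scheme
      \<Rightarrow> ('a \<times> 'b \<Rightarrow> 'r) set"
  where "tensor_relations R A B =
    (let V = free_module R (carrier A \<times> carrier B); e = free_gen R in
      {e (a \<oplus>\<^bsub>A\<^esub> a', b) \<ominus>\<^bsub>V\<^esub> (e (a, b) \<oplus>\<^bsub>V\<^esub> e (a', b)) | a a' b.
         a \<in> carrier A \<and> a' \<in> carrier A \<and> b \<in> carrier B} \<union>
      {e (a, b \<oplus>\<^bsub>B\<^esub> b') \<ominus>\<^bsub>V\<^esub> (e (a, b) \<oplus>\<^bsub>V\<^esub> e (a, b')) | a b b'.
         a \<in> carrier A \<and> b \<in> carrier B \<and> b' \<in> carrier B} \<union>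
      {e (r \<odot>\<^bsub>A\<^esub> a, b) \<ominus>\<^bsub>V\<^esub> r \<odot>\<^bsub>V\<^esub> e (a, b) | r a b.
         r \<in> carrier R \<and> a \<in> carrier A \<and> b \<in> carrier B} \<union>
      {e (a, r \<odot>\<^bsub>B\<^esub> b) \<ominus>\<^bsub>V\<^esub> r \<odot>\<^bsub>V\<^esub> e (a, b) | r a b.
         r \<in> carrier R \<and> a \<in> carrier A \<and> b \<in> carrier B})"

definition tensor_null ::
    "('r, 'm) ring_scheme \<Rightarrow> ('r, 'a, 'm1) module_scheme \<Rightarrow> ('r, 'b, 'm2) module_scheme
      \<Rightarrow> ('a \<times> 'b \<Rightarrow> 'r) set"
  where "tensor_null R A B =
    module.span R (free_module R (carrier A \<times> carrier B)) (tensor_relations R A B)"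

definition tensor ::
    "('r, 'm) ring_scheme \<Rightarrow> ('r, 'a, 'm1) module_scheme \<Rightarrow> ('r, 'b, 'm2) module_scheme
      \<Rightarrow> ('r, ('a \<times> 'b \<Rightarrow> 'r) set) module"
  where "tensor R A B =
    quotient_module (free_module R (carrier A \<times> carrier B)) (tensor_null R A B)"

definition pure_tensor ::
    "('r, 'm) ring_scheme \<Rightarrow> ('r, 'a, 'm1) module_scheme \<Rightarrow> ('r, 'b, 'm2) module_scheme
      \<Rightarrow> 'a \<Rightarrow> 'b \<Rightarrow> ('a \<times> 'b \<Rightarrow> 'r) set"
  where "pure_tensor R A B a b =
    tensor_null R A B +>\<^bsub>free_module R (carrier A \<times> carrier B)\<^esub> free_gen R (a, b)"

definition bilinear_maps ::
    "('r, 'm) ring_scheme \<Rightarrow> ('r, 'a, 'm1) module_scheme \<Rightarrow> ('r, 'b, 'm2) module_scheme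
      \<Rightarrow> ('r, 't, 'm3) module_scheme \<Rightarrow> ('a \<Rightarrow> 'b \<Rightarrow> 't) set"
  where "bilinear_maps R A B T =
    {\<beta>. (\<forall>b\<in>carrier B. (\<lambda>a. \<beta> a b) \<in> module_hom R A T) \<and>
        (\<forall>a\<in>carrier A. \<beta> a \<in> module_hom R B T)}"

lemma tensor_relations_closed:
  assumes "module R A" "module R B"
  shows "tensor_relations R A B \<subseteq> carrier (free_module R (carrier A \<times> carrier B))"
proof -
  interpret A: module R A by fact
  interpret B: module R B by fact
  let ?V = "free_module R (carrier A \<times> carrier B)"
  interpret V: module R ?V by (rule free_module_module) (rule A.is_cring)
  have g: "free_gen R (a, b) \<in> carrier ?V" if "a \<in> carrier A" "b \<in> carrier B" for a b
    using that by (intro free_gen_closed A.is_cring) auto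
  show ?thesis
    unfolding tensor_relations_def Let_def
    by (safe; intro V.minus_closed V.a_closed V.smult_closed g;
      (assumption | intro A.a_closed B.a_closed A.smult_closed B.smult_closed))
qed

lemma tensor_null_submodule:
  assumes "module R A" "module R B"
  shows "submodule R (tensor_null R A B) (free_module R (carrier A \<times> carrier B))"
proof -
  interpret A: module R A by fact
  interpret V: module R "free_module R (carrier A \<times> carrier B)"
    by (rule free_module_module) (rule A.is_cring)
  show ?thesis
    unfolding tensor_null_def by (rule V.span_is_submodule) (rule tensor_relations_closed[OF assms])
qed

lemma tensor_module:
  assumes "module R A" "module R B"
  shows "module R (tensor R A B)"
proof -
  interpret A: module R A by fact
  show ?thesis unfolding tensor_def
    by (intro quotient_module_facts(1) free_module_module tensor_null_submodule assms A.is_cring)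
qed

lemma tensor_vectorspace:
  assumes "vectorspace F V" "vectorspace F W"
  shows "vectorspace F (tensor F V W)"
  using assms tensor_module[of F V W] by (simp add: vectorspace_def)

lemma pure_tensor_bilinear:
  assumes "module R A" "module R B"
  shows "pure_tensor R A B \<in> bilinear_maps R A B (tensor R A B)"
proof -
  interpret A: module R A by fact
  interpret B: module R B by fact
  let ?V = "free_module R (carrier A \<times> carrier B)" and ?N = "tensor_null R A B"
  interpret V: module R ?V by (rule free_module_module) (rule A.is_cring)
  interpret T: module R "tensor R A B" by (intro tensor_module assms)
  note N = tensor_null_submodule[OF assms]
  interpret N: submodule R ?N ?V by (rule N)
  interpret q: mod_hom R ?V "tensor R A B" "\<lambda>x. ?N +>\<^bsub>?V\<^esub> x"
    using quotient_module_facts(2)[OF V.module_axioms N]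
    by unfold_locales (simp add: tensor_def)
  have g: "free_gen R (a, b) \<in> carrier ?V" if "a \<in> carrier A" "b \<in> carrier B" for a b
    using that by (intro free_gen_closed A.is_cring) auto
  note rel = tensor_relations_closed[OF assms]
  have eq: "?N +>\<^bsub>?V\<^esub> x = ?N +>\<^bsub>?V\<^esub> y"
    if "x \<ominus>\<^bsub>?V\<^esub> y \<in> tensor_relations R A B" "x \<in> carrier ?V" "y \<in> carrier ?V" for x y
  proof -
    have "x \<ominus>\<^bsub>?V\<^esub> y \<in> ?N" using that(1) V.in_own_span[OF rel] by (auto simp: tensor_null_def)
    then have 0: "?N +>\<^bsub>?V\<^esub> (x \<ominus>\<^bsub>?V\<^esub> y) = \<zero>\<^bsub>tensor R A B\<^esub>"
      using quotient_module_facts(4)[OF V.module_axioms N] by (simp add: tensor_def)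
    have "x = (x \<ominus>\<^bsub>?V\<^esub> y) \<oplus>\<^bsub>?V\<^esub> y"
      using that(2,3) by (simp add: a_minus_def V.a_assoc V.l_neg)
    then have "?N +>\<^bsub>?V\<^esub> x = ?N +>\<^bsub>?V\<^esub> ((x \<ominus>\<^bsub>?V\<^esub> y) \<oplus>\<^bsub>?V\<^esub> y)"
      by (rule arg_cong)
    also have "\<dots> = (?N +>\<^bsub>?V\<^esub> (x \<ominus>\<^bsub>?V\<^esub> y)) \<oplus>\<^bsub>tensor R A B\<^esub> (?N +>\<^bsub>?V\<^esub> y)"
      by (rule q.f_add[OF V.minus_closed[OF that(2,3)] that(3)])
    also have "\<dots> = ?N +>\<^bsub>?V\<^esub> y"
      unfolding 0 by (rule T.l_zero[OF q.f_im[OF that(3)]])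
    finally show ?thesis .
  qed
  have add_l: "pure_tensor R A B (a \<oplus>\<^bsub>A\<^esub> a') b =
      pure_tensor R A B a b \<oplus>\<^bsub>tensor R A B\<^esub> pure_tensor R A B a' b"
    if ab: "a \<in> carrier A" "a' \<in> carrier A" "b \<in> carrier B" for a a' b
  proof -
    have "?N +>\<^bsub>?V\<^esub> free_gen R (a \<oplus>\<^bsub>A\<^esub> a', b) =
        ?N +>\<^bsub>?V\<^esub> (free_gen R (a, b) \<oplus>\<^bsub>?V\<^esub> free_gen R (a', b))"
    proof (rule eq)
      show "free_gen R (a \<oplus>\<^bsub>A\<^esub> a', b) \<ominus>\<^bsub>?V\<^esub> (free_gen R (a, b) \<oplus>\<^bsub>?V\<^esub> free_gen R (a', b)) \<in> tensor_relations R A B"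
        unfolding tensor_relations_def Let_def using ab by blast
    qed (use ab g in simp_all)
    then show ?thesis using g ab by (simp add: pure_tensor_def)
  qed
  have add_r: "pure_tensor R A B a (b \<oplus>\<^bsub>B\<^esub> b') =
      pure_tensor R A B a b \<oplus>\<^bsub>tensor R A B\<^esub> pure_tensor R A B a b'"
    if ab: "a \<in> carrier A" "b \<in> carrier B" "b' \<in> carrier B" for a b b'
  proof -
    have "?N +>\<^bsub>?V\<^esub> free_gen R (a, b \<oplus>\<^bsub>B\<^esub> b') =
        ?N +>\<^bsub>?V\<^esub> (free_gen R (a, b) \<oplus>\<^bsub>?V\<^esub> free_gen R (a, b'))"
    proof (rule eq)
      show "free_gen R (a, b \<oplus>\<^bsub>B\<^esub> b') \<ominus>\<^bsub>?V\<^esub> (free_gen R (a, b) \<oplus>\<^bsub>?V\<^esub> free_gen R (a, b')) \<in> tensor_relations R A B"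
        unfolding tensor_relations_def Let_def using ab by blast
    qed (use ab g in simp_all)
    then show ?thesis using g ab by (simp add: pure_tensor_def)
  qed
  have smult_l: "pure_tensor R A B (r \<odot>\<^bsub>A\<^esub> a) b = r \<odot>\<^bsub>tensor R A B\<^esub> pure_tensor R A B a b"
    if ab: "r \<in> carrier R" "a \<in> carrier A" "b \<in> carrier B" for r a b
  proof -
    have "?N +>\<^bsub>?V\<^esub> free_gen R (r \<odot>\<^bsub>A\<^esub> a, b) = ?N +>\<^bsub>?V\<^esub> (r \<odot>\<^bsub>?V\<^esub> free_gen R (a, b))"
    proof (rule eq)
      show "free_gen R (r \<odot>\<^bsub>A\<^esub> a, b) \<ominus>\<^bsub>?V\<^esub> r \<odot>\<^bsub>?V\<^esub> free_gen R (a, b) \<in> tensor_relations R A B"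
        unfolding tensor_relations_def Let_def using ab by blast
    qed (use ab g in simp_all)
    then show ?thesis using g ab by (simp add: pure_tensor_def)
  qed
  have smult_r: "pure_tensor R A B a (r \<odot>\<^bsub>B\<^esub> b) = r \<odot>\<^bsub>tensor R A B\<^esub> pure_tensor R A B a b"
    if ab: "r \<in> carrier R" "a \<in> carrier A" "b \<in> carrier B" for r a b
  proof -
    have "?N +>\<^bsub>?V\<^esub> free_gen R (a, r \<odot>\<^bsub>B\<^esub> b) = ?N +>\<^bsub>?V\<^esub> (r \<odot>\<^bsub>?V\<^esub> free_gen R (a, b))"
    proof (rule eq)
      show "free_gen R (a, r \<odot>\<^bsub>B\<^esub> b) \<ominus>\<^bsub>?V\<^esub> r \<odot>\<^bsub>?V\<^esub> free_gen R (a, b) \<in> tensor_relations R A B"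
        unfolding tensor_relations_def Let_def using ab by blast
    qed (use ab g in simp_all)
    then show ?thesis using g ab by (simp add: pure_tensor_def)
  qed
  have "pure_tensor R A B a b \<in> carrier (tensor R A B)" if "a \<in> carrier A" "b \<in> carrier B" for a b
    using q.f_im[OF g[OF that]] by (simp add: pure_tensor_def)
  then show ?thesis
    by (auto simp: bilinear_maps_def module_hom_def add_l add_r smult_l smult_r)
qed

lemma tensor_hom_eqI:
  assumes "module R A" "module R B" "module R T"
    and \<phi>: "\<phi> \<in> module_hom R (tensor R A B) T"
    and \<psi>: "\<psi> \<in> module_hom R (tensor R A B) T"
    and eq: "\<And>a b. a \<in> carrier A \<Longrightarrow> b \<in> carrier B \<Longrightarrow>
      \<phi> (pure_tensor R A B a b) = \<psi> (pure_tensor R A B a b)"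
    and u: "u \<in> carrier (tensor R A B)"
  shows "\<phi> u = \<psi> u"
proof -
  interpret A: module R A by fact
  let ?V = "free_module R (carrier A \<times> carrier B)" and ?N = "tensor_null R A B"
  note V = free_module_module[OF A.is_cring, of "carrier A \<times> carrier B"]
  note N = tensor_null_submodule[OF assms(1,2)]
  note q = quotient_module_facts[OF V N, folded tensor_def]
  have comp: "(\<lambda>x. \<chi> (?N +>\<^bsub>?V\<^esub> x)) \<in> module_hom R ?V T"
    if "\<chi> \<in> module_hom R (tensor R A B) T" for \<chi>
    using that q(2) unfolding module_hom_def by (auto simp: Pi_iff)
  obtain h where h: "h \<in> carrier ?V" "u = ?N +>\<^bsub>?V\<^esub> h" using u q(3) by auto
  show ?thesis
    unfolding h(2)
    by (rule free_module_hom_eqI[OF assms(3) comp[OF \<phi>] comp[OF \<psi>] _ h(1)])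
      (use eq in \<open>auto simp: pure_tensor_def\<close>)
qed

lemma tensor_universal:
  assumes "module R A" "module R B" "module R T" and \<beta>: "\<beta> \<in> bilinear_maps R A B T"
  shows "\<exists>!\<phi>. \<phi> \<in> module_hom R (tensor R A B) T \<and> \<phi> \<in> extensional (carrier (tensor R A B)) \<and>
      (\<forall>a\<in>carrier A. \<forall>b\<in>carrier B. \<phi> (pure_tensor R A B a b) = \<beta> a b)"
proof -
  interpret A: module R A by fact
  interpret B: module R B by fact
  interpret T: module R T by fact
  let ?V = "free_module R (carrier A \<times> carrier B)" and ?N = "tensor_null R A B"
  interpret V: module R ?V by (rule free_module_module) (rule A.is_cring)
  interpret Q: module R "tensor R A B" by (intro tensor_module assms)
  note N = tensor_null_submodule[OF assms(1,2)]
  interpret N: submodule R ?N ?V by (rule N)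
  note q = quotient_module_facts[OF V.module_axioms N, folded tensor_def]
  interpret q: mod_hom R ?V "tensor R A B" "\<lambda>x. ?N +>\<^bsub>?V\<^esub> x"
    by unfold_locales (rule q(2))
  have \<beta>_closed: "\<beta> a b \<in> carrier T" if "a \<in> carrier A" "b \<in> carrier B" for a b
    using \<beta> that by (auto simp: bilinear_maps_def module_hom_def)
  have \<beta>_bilin:
    "\<And>a a' b. a \<in> carrier A \<Longrightarrow> a' \<in> carrier A \<Longrightarrow> b \<in> carrier B \<Longrightarrow>
      \<beta> (a \<oplus>\<^bsub>A\<^esub> a') b = \<beta> a b \<oplus>\<^bsub>T\<^esub> \<beta> a' b"
    "\<And>a b b'. a \<in> carrier A \<Longrightarrow> b \<in> carrier B \<Longrightarrow> b' \<in> carrier B \<Longrightarrow>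
      \<beta> a (b \<oplus>\<^bsub>B\<^esub> b') = \<beta> a b \<oplus>\<^bsub>T\<^esub> \<beta> a b'"
    "\<And>r a b. r \<in> carrier R \<Longrightarrow> a \<in> carrier A \<Longrightarrow> b \<in> carrier B \<Longrightarrow>
      \<beta> (r \<odot>\<^bsub>A\<^esub> a) b = r \<odot>\<^bsub>T\<^esub> \<beta> a b"
    "\<And>r a b. r \<in> carrier R \<Longrightarrow> a \<in> carrier A \<Longrightarrow> b \<in> carrier B \<Longrightarrow>
      \<beta> a (r \<odot>\<^bsub>B\<^esub> b) = r \<odot>\<^bsub>T\<^esub> \<beta> a b"
    using \<beta> unfolding bilinear_maps_def module_hom_def by auto
  obtain \<Phi> where \<Phi>: "\<Phi> \<in> module_hom R ?V T"
    and \<Phi>_gen': "\<And>x. x \<in> carrier A \<times> carrier B \<Longrightarrow> \<Phi> (free_gen R x) = case_prod \<beta> x"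
    by (rule free_module_ext[OF assms(3), of "carrier A \<times> carrier B" "case_prod \<beta>"])
      (auto simp: \<beta>_closed)
  have \<Phi>_gen: "\<Phi> (free_gen R (a, b)) = \<beta> a b" if "a \<in> carrier A" "b \<in> carrier B" for a b
    using \<Phi>_gen'[of "(a, b)"] that by simp
  interpret \<Phi>: mod_hom R ?V T \<Phi> by unfold_locales (rule \<Phi>)
  have g: "free_gen R (a, b) \<in> carrier ?V" if "a \<in> carrier A" "b \<in> carrier B" for a b
    using that by (intro free_gen_closed A.is_cring) auto
  have T_eq: "x \<ominus>\<^bsub>T\<^esub> x = \<zero>\<^bsub>T\<^esub>" if "x \<in> carrier T" for x
    using that by (simp add: a_minus_def T.r_neg)
  have in_ker: "x \<ominus>\<^bsub>?V\<^esub> y \<in> \<Phi>.ker"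
    if "x \<in> carrier ?V" "y \<in> carrier ?V" "\<Phi> x = \<Phi> y" for x y
    using that \<Phi>.f_im[OF that(2)] by (simp add: \<Phi>.ker_def T_eq)
  have ker1: "free_gen R (a \<oplus>\<^bsub>A\<^esub> a', b) \<ominus>\<^bsub>?V\<^esub>
      (free_gen R (a, b) \<oplus>\<^bsub>?V\<^esub> free_gen R (a', b)) \<in> \<Phi>.ker"
    if "a \<in> carrier A" "a' \<in> carrier A" "b \<in> carrier B" for a a' b
    by (rule in_ker) (use that in \<open>simp_all add: g \<Phi>_gen \<beta>_bilin\<close>)
  have ker2: "free_gen R (a, b \<oplus>\<^bsub>B\<^esub> b') \<ominus>\<^bsub>?V\<^esub>
      (free_gen R (a, b) \<oplus>\<^bsub>?V\<^esub> free_gen R (a, b')) \<in> \<Phi>.ker"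
    if "a \<in> carrier A" "b \<in> carrier B" "b' \<in> carrier B" for a b b'
    by (rule in_ker) (use that in \<open>simp_all add: g \<Phi>_gen \<beta>_bilin\<close>)
  have ker3: "free_gen R (r \<odot>\<^bsub>A\<^esub> a, b) \<ominus>\<^bsub>?V\<^esub> r \<odot>\<^bsub>?V\<^esub> free_gen R (a, b) \<in> \<Phi>.ker"
    if "r \<in> carrier R" "a \<in> carrier A" "b \<in> carrier B" for r a b
    by (rule in_ker) (use that in \<open>simp_all add: g \<Phi>_gen \<beta>_bilin\<close>)
  have ker4: "free_gen R (a, r \<odot>\<^bsub>B\<^esub> b) \<ominus>\<^bsub>?V\<^esub> r \<odot>\<^bsub>?V\<^esub> free_gen R (a, b) \<in> \<Phi>.ker"
    if "r \<in> carrier R" "a \<in> carrier A" "b \<in> carrier B" for r a b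
    by (rule in_ker) (use that in \<open>simp_all add: g \<Phi>_gen \<beta>_bilin\<close>)
  have "tensor_relations R A B \<subseteq> \<Phi>.ker"
    unfolding tensor_relations_def Let_def
    by safe (erule (2) ker1 ker2 ker3 ker4)+
  then have ker: "?N \<subseteq> \<Phi>.ker"
    unfolding tensor_null_def by (rule V.span_is_subset) (rule \<Phi>.ker_is_submodule)
  define \<phi> where "\<phi> = restrict (\<lambda>X. \<Phi> (SOME h. h \<in> X)) (carrier (tensor R A B))"
  have \<phi>: "\<phi> (?N +>\<^bsub>?V\<^esub> h) = \<Phi> h" if h: "h \<in> carrier ?V" for h
  proof -
    let ?h = "SOME k. k \<in> ?N +>\<^bsub>?V\<^esub> h"
    have "\<zero>\<^bsub>?V\<^esub> \<oplus>\<^bsub>?V\<^esub> h \<in> ?N +>\<^bsub>?V\<^esub> h"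
      using N.zero_closed unfolding a_r_coset_def' by blast
    then have "?h \<in> ?N +>\<^bsub>?V\<^esub> h" by (rule someI[where P = "\<lambda>k. k \<in> ?N +>\<^bsub>?V\<^esub> h"])
    then obtain n where n: "n \<in> ?N" "?h = n \<oplus>\<^bsub>?V\<^esub> h" by (auto simp: a_r_coset_def')
    have "\<Phi> n = \<zero>\<^bsub>T\<^esub>" "n \<in> carrier ?V" using n(1) ker by (auto simp: \<Phi>.ker_def)
    then have "\<Phi> ?h = \<Phi> h" unfolding n(2) using h by simp
    then show ?thesis using q.f_im[OF h] by (simp add: \<phi>_def)
  qed
  have "\<phi> \<in> module_hom R (tensor R A B) T"
    unfolding module_hom_def
  proof (safe)
    fix u assume "u \<in> carrier (tensor R A B)"
    then show "\<phi> u \<in> carrier T" using \<phi> \<Phi>.f_im by (auto simp: q(3))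
  next
    fix u v assume "u \<in> carrier (tensor R A B)" "v \<in> carrier (tensor R A B)"
    then obtain h k where hk: "h \<in> carrier ?V" "k \<in> carrier ?V"
      "u = ?N +>\<^bsub>?V\<^esub> h" "v = ?N +>\<^bsub>?V\<^esub> k" by (auto simp: q(3))
    have "u \<oplus>\<^bsub>tensor R A B\<^esub> v = ?N +>\<^bsub>?V\<^esub> (h \<oplus>\<^bsub>?V\<^esub> k)"
      unfolding hk(3,4) by (rule q.f_add[symmetric]) (use hk in auto)
    then have "\<phi> (u \<oplus>\<^bsub>tensor R A B\<^esub> v) = \<Phi> (h \<oplus>\<^bsub>?V\<^esub> k)"
      using \<phi>[OF V.a_closed[OF hk(1,2)]] by simp
    then show "\<phi> (u \<oplus>\<^bsub>tensor R A B\<^esub> v) = \<phi> u \<oplus>\<^bsub>T\<^esub> \<phi> v"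
      using \<Phi>.f_add[OF hk(1,2)] \<phi>[OF hk(1)] \<phi>[OF hk(2)] hk(3,4) by simp
  next
    fix r u assume r: "r \<in> carrier R" and "u \<in> carrier (tensor R A B)"
    then obtain h where h: "h \<in> carrier ?V" "u = ?N +>\<^bsub>?V\<^esub> h" by (auto simp: q(3))
    have "r \<odot>\<^bsub>tensor R A B\<^esub> u = ?N +>\<^bsub>?V\<^esub> (r \<odot>\<^bsub>?V\<^esub> h)"
      unfolding h(2) by (rule q.f_smult[symmetric]) (use r h in auto)
    then have "\<phi> (r \<odot>\<^bsub>tensor R A B\<^esub> u) = \<Phi> (r \<odot>\<^bsub>?V\<^esub> h)"
      using \<phi>[OF V.smult_closed[OF r h(1)]] by simp
    then show "\<phi> (r \<odot>\<^bsub>tensor R A B\<^esub> u) = r \<odot>\<^bsub>T\<^esub> \<phi> u"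
      using \<Phi>.f_smult[OF r h(1)] \<phi>[OF h(1)] h(2) by simp
  qed
  moreover have "\<phi> \<in> extensional (carrier (tensor R A B))" by (simp add: \<phi>_def)
  moreover have "\<phi> (pure_tensor R A B a b) = \<beta> a b" if "a \<in> carrier A" "b \<in> carrier B" for a b
    using that g by (simp add: pure_tensor_def \<phi> \<Phi>_gen)
  ultimately show ?thesis
  proof (intro ex1I[of _ \<phi>], goal_cases)
    case 1
    then show ?case by simp
  next
    case (2 \<psi>)
    show ?case
    proof (rule extensionalityI[of _ "carrier (tensor R A B)"])
      show "\<psi> u = \<phi> u" if "u \<in> carrier (tensor R A B)" for u
        by (rule tensor_hom_eqI[OF assms(1-3) _ _ _ that]) (use 2 in auto)
    qed (use 2 in auto)
  qed
qed

text \<open>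
  The linear map on \<open>A \<otimes> B\<close> given on pure tensors by \<open>a \<otimes> b \<mapsto> \<beta> a b\<close>. It is well defined whenever
  \<open>\<beta>\<close> is bilinear, by \<open>tensor_universal\<close>.
\<close>

definition tensor_lift ::
    "('r, 'm) ring_scheme \<Rightarrow> ('r, 'a, 'm1) module_scheme \<Rightarrow> ('r, 'b, 'm2) module_scheme
      \<Rightarrow> ('r, 't, 'm3) module_scheme \<Rightarrow> ('a \<Rightarrow> 'b \<Rightarrow> 't) \<Rightarrow> ('a \<times> 'b \<Rightarrow> 'r) set \<Rightarrow> 't"
  where "tensor_lift R A B T \<beta> =
    (THE \<phi>. \<phi> \<in> module_hom R (tensor R A B) T \<and> \<phi> \<in> extensional (carrier (tensor R A B)) \<and>
      (\<forall>a\<in>carrier A. \<forall>b\<in>carrier B. \<phi> (pure_tensor R A B a b) = \<beta> a b))"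

lemma tensor_lift_facts:
  assumes "module R A" "module R B" "module R T" and "\<beta> \<in> bilinear_maps R A B T"
  shows tensor_lift_hom: "tensor_lift R A B T \<beta> \<in> module_hom R (tensor R A B) T"
    and tensor_lift_pure: "\<And>a b. a \<in> carrier A \<Longrightarrow> b \<in> carrier B \<Longrightarrow>
      tensor_lift R A B T \<beta> (pure_tensor R A B a b) = \<beta> a b"
  using theI'[OF tensor_universal[OF assms]] unfolding tensor_lift_def by blast+

lemma module_hom_sum:
  assumes "module R V" "module R W" "\<phi> \<in> module_hom R V W" "\<psi> \<in> module_hom R V W"
  shows "(\<lambda>x. \<phi> x \<oplus>\<^bsub>W\<^esub> \<psi> x) \<in> module_hom R V W"
proof -
  interpret W: module R W by fact
  show ?thesis
    using assms(3,4) by (auto simp: module_hom_def Pi_iff W.a_ac W.smult_r_distr)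
qed

lemma module_hom_scale:
  assumes "module R V" "module R W" "\<phi> \<in> module_hom R V W" "r \<in> carrier R"
  shows "(\<lambda>x. r \<odot>\<^bsub>W\<^esub> \<phi> x) \<in> module_hom R V W"
proof -
  interpret W: module R W by fact
  show ?thesis
    using assms(3,4)
    by (auto simp: module_hom_def Pi_iff W.smult_r_distr W.R.m_comm simp flip: W.smult_assoc1)
qed

lemma tensor_lift_bilinear:
  assumes A: "module R A" and B: "module R B" and C: "module R C" and T: "module R T"
    and \<beta>: "\<And>a. a \<in> carrier A \<Longrightarrow> \<beta> a \<in> bilinear_maps R B C T"
    and lin: "\<And>b c. b \<in> carrier B \<Longrightarrow> c \<in> carrier C \<Longrightarrow> (\<lambda>a. \<beta> a b c) \<in> module_hom R A T"
  shows "(\<lambda>a. tensor_lift R B C T (\<beta> a)) \<in> bilinear_maps R A (tensor R B C) T"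
    and "(\<lambda>u a. tensor_lift R B C T (\<beta> a) u) \<in> bilinear_maps R (tensor R B C) A T"
proof -
  interpret A: module R A by fact
  interpret T: module R T by fact
  note BC = tensor_module[OF B C]
  note h = tensor_lift_hom[OF B C T \<beta>] and p = tensor_lift_pure[OF B C T \<beta>]
  have add: "tensor_lift R B C T (\<beta> (a \<oplus>\<^bsub>A\<^esub> a')) u =
      tensor_lift R B C T (\<beta> a) u \<oplus>\<^bsub>T\<^esub> tensor_lift R B C T (\<beta> a') u"
    if "a \<in> carrier A" "a' \<in> carrier A" "u \<in> carrier (tensor R B C)" for a a' u
    by (rule tensor_hom_eqI[OF B C T h module_hom_sum[OF BC T h h] _ that(3)])
      (use that lin in \<open>auto simp: p module_hom_def\<close>)
  have scale: "tensor_lift R B C T (\<beta> (r \<odot>\<^bsub>A\<^esub> a)) u = r \<odot>\<^bsub>T\<^esub> tensor_lift R B C T (\<beta> a) u"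
    if "r \<in> carrier R" "a \<in> carrier A" "u \<in> carrier (tensor R B C)" for r a u
    by (rule tensor_hom_eqI[OF B C T h module_hom_scale[OF BC T h] _ that(3)])
      (use that lin in \<open>auto simp: p module_hom_def\<close>)
  show "(\<lambda>a. tensor_lift R B C T (\<beta> a)) \<in> bilinear_maps R A (tensor R B C) T"
    and "(\<lambda>u a. tensor_lift R B C T (\<beta> a) u) \<in> bilinear_maps R (tensor R B C) A T"
    using h add scale by (auto simp: bilinear_maps_def module_hom_def Pi_iff)
qed

definition tensor_map ::
    "('r, 'm) ring_scheme \<Rightarrow> ('r, 'a, 'm1) module_scheme \<Rightarrow> ('r, 'b, 'm2) module_scheme
      \<Rightarrow> ('r, 'c, 'm3) module_scheme \<Rightarrow> ('r, 'd, 'm4) module_scheme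
      \<Rightarrow> ('a \<Rightarrow> 'c) \<Rightarrow> ('b \<Rightarrow> 'd) \<Rightarrow> ('a \<times> 'b \<Rightarrow> 'r) set \<Rightarrow> ('c \<times> 'd \<Rightarrow> 'r) set"
  where "tensor_map R A B C D f g =
    tensor_lift R A B (tensor R C D) (\<lambda>a b. pure_tensor R C D (f a) (g b))"

lemma tensor_map_facts:
  assumes A: "module R A" and B: "module R B" and C: "module R C" and D: "module R D"
    and f: "f \<in> module_hom R A C" and g: "g \<in> module_hom R B D"
  shows tensor_map_hom: "tensor_map R A B C D f g \<in> module_hom R (tensor R A B) (tensor R C D)"
    and tensor_map_pure: "\<And>a b. a \<in> carrier A \<Longrightarrow> b \<in> carrier B \<Longrightarrow>
      tensor_map R A B C D f g (pure_tensor R A B a b) = pure_tensor R C D (f a) (g b)"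
proof -
  have "(\<lambda>a b. pure_tensor R C D (f a) (g b)) \<in> bilinear_maps R A B (tensor R C D)"
    using pure_tensor_bilinear[OF C D] f g
    by (auto simp: bilinear_maps_def module_hom_def Pi_iff)
  note * = A B tensor_module[OF C D] this
  show "tensor_map R A B C D f g \<in> module_hom R (tensor R A B) (tensor R C D)"
    unfolding tensor_map_def by (rule tensor_lift_hom[OF *])
  show "tensor_map R A B C D f g (pure_tensor R A B a b) = pure_tensor R C D (f a) (g b)"
    if "a \<in> carrier A" "b \<in> carrier B" for a b
    unfolding tensor_map_def by (rule tensor_lift_pure[OF * that])
qed

definition tensor_swap ::
    "('r, 'm) ring_scheme \<Rightarrow> ('r, 'a, 'm1) module_scheme \<Rightarrow> ('r, 'b, 'm2) module_scheme
      \<Rightarrow> ('a \<times> 'b \<Rightarrow> 'r) set \<Rightarrow> ('b \<times> 'a \<Rightarrow> 'r) set"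
  where "tensor_swap R A B =
    tensor_lift R A B (tensor R B A) (\<lambda>a b. pure_tensor R B A b a)"

lemma tensor_swap_facts:
  assumes A: "module R A" and B: "module R B"
  shows tensor_swap_hom: "tensor_swap R A B \<in> module_hom R (tensor R A B) (tensor R B A)"
    and tensor_swap_pure: "\<And>a b. a \<in> carrier A \<Longrightarrow> b \<in> carrier B \<Longrightarrow>
      tensor_swap R A B (pure_tensor R A B a b) = pure_tensor R B A b a"
proof -
  have "(\<lambda>a b. pure_tensor R B A b a) \<in> bilinear_maps R A B (tensor R B A)"
    using pure_tensor_bilinear[OF B A] by (auto simp: bilinear_maps_def)
  note * = A B tensor_module[OF B A] this
  show "tensor_swap R A B \<in> module_hom R (tensor R A B) (tensor R B A)"
    unfolding tensor_swap_def by (rule tensor_lift_hom[OF *])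
  show "tensor_swap R A B (pure_tensor R A B a b) = pure_tensor R B A b a"
    if "a \<in> carrier A" "b \<in> carrier B" for a b
    unfolding tensor_swap_def by (rule tensor_lift_pure[OF * that])
qed

text \<open>
  The canonical identification \<open>A \<otimes> (B \<otimes> C) \<rightarrow> (A \<otimes> B) \<otimes> C\<close>, \<open>a \<otimes> (b \<otimes> c) \<mapsto> (a \<otimes> b) \<otimes> c\<close>. Triple
  tensor products are bracketed to the left below, and this map is inserted wherever the usual
  notation identifies the two bracketings.
\<close>

definition tensor_assoc ::
    "('r, 'm) ring_scheme \<Rightarrow> ('r, 'a, 'm1) module_scheme \<Rightarrow> ('r, 'b, 'm2) module_scheme
      \<Rightarrow> ('r, 'c, 'm3) module_scheme
      \<Rightarrow> ('a \<times> ('b \<times> 'c \<Rightarrow> 'r) set \<Rightarrow> 'r) set \<Rightarrow> (('a \<times> 'b \<Rightarrow> 'r) set \<times> 'c \<Rightarrow> 'r) set"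
  where "tensor_assoc R A B C =
    tensor_lift R A (tensor R B C) (tensor R (tensor R A B) C)
      (\<lambda>a. tensor_lift R B C (tensor R (tensor R A B) C)
        (\<lambda>b c. pure_tensor R (tensor R A B) C (pure_tensor R A B a b) c))"

lemma tensor_assoc_facts:
  assumes A: "module R A" and B: "module R B" and C: "module R C"
  shows tensor_assoc_hom: "tensor_assoc R A B C \<in>
      module_hom R (tensor R A (tensor R B C)) (tensor R (tensor R A B) C)"
    and tensor_assoc_pure: "\<And>a b c. a \<in> carrier A \<Longrightarrow> b \<in> carrier B \<Longrightarrow> c \<in> carrier C \<Longrightarrow>
      tensor_assoc R A B C (pure_tensor R A (tensor R B C) a (pure_tensor R B C b c)) =
      pure_tensor R (tensor R A B) C (pure_tensor R A B a b) c"
proof -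
  note AB = tensor_module[OF A B] and BC = tensor_module[OF B C]
  note T = tensor_module[OF AB C]
  note b = pure_tensor_bilinear[OF A B] pure_tensor_bilinear[OF AB C]
  let ?\<beta> = "\<lambda>a b c. pure_tensor R (tensor R A B) C (pure_tensor R A B a b) c"
  have \<beta>: "?\<beta> a \<in> bilinear_maps R B C (tensor R (tensor R A B) C)" if "a \<in> carrier A" for a
    using that b by (auto simp: bilinear_maps_def module_hom_def Pi_iff)
  have "(\<lambda>a. ?\<beta> a b c) \<in> module_hom R A (tensor R (tensor R A B) C)"
    if "b \<in> carrier B" "c \<in> carrier C" for b c
    using that b by (auto simp: bilinear_maps_def module_hom_def Pi_iff)
  note * = A BC T tensor_lift_bilinear(1)[OF A B C T \<beta> this]
  show "tensor_assoc R A B C \<in>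
      module_hom R (tensor R A (tensor R B C)) (tensor R (tensor R A B) C)"
    unfolding tensor_assoc_def by (rule tensor_lift_hom[OF *])
  show "tensor_assoc R A B C (pure_tensor R A (tensor R B C) a (pure_tensor R B C b c)) =
      pure_tensor R (tensor R A B) C (pure_tensor R A B a b) c"
    if "a \<in> carrier A" "b \<in> carrier B" "c \<in> carrier C" for a b c
  proof -
    have "pure_tensor R B C b c \<in> carrier (tensor R B C)"
      using pure_tensor_bilinear[OF B C] that by (auto simp: bilinear_maps_def module_hom_def)
    then show ?thesis
      unfolding tensor_assoc_def
      using that by (simp add: tensor_lift_pure[OF *] tensor_lift_pure[OF B C T \<beta>])
  qed
qed

text \<open>The map \<open>\<xi> : (x \<otimes> y) \<otimes> z \<mapsto> (y \<otimes> z) \<otimes> x\<close>.\<close>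

definition tensor_cycle ::
    "('r, 'm) ring_scheme \<Rightarrow> ('r, 'a, 'm1) module_scheme
      \<Rightarrow> (('a \<times> 'a \<Rightarrow> 'r) set \<times> 'a \<Rightarrow> 'r) set \<Rightarrow> (('a \<times> 'a \<Rightarrow> 'r) set \<times> 'a \<Rightarrow> 'r) set"
  where "tensor_cycle R L =
    tensor_lift R (tensor R L L) L (tensor R (tensor R L L) L)
      (\<lambda>u z. tensor_lift R L L (tensor R (tensor R L L) L)
        (\<lambda>x y. pure_tensor R (tensor R L L) L (pure_tensor R L L y z) x) u)"

lemma tensor_cycle_facts:
  assumes L: "module R L"
  shows tensor_cycle_hom: "tensor_cycle R L \<in>
      module_hom R (tensor R (tensor R L L) L) (tensor R (tensor R L L) L)"
    and tensor_cycle_pure: "\<And>x y z. x \<in> carrier L \<Longrightarrow> y \<in> carrier L \<Longrightarrow> z \<in> carrier L \<Longrightarrow>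
      tensor_cycle R L (pure_tensor R (tensor R L L) L (pure_tensor R L L x y) z) =
      pure_tensor R (tensor R L L) L (pure_tensor R L L y z) x"
proof -
  note LL = tensor_module[OF L L]
  note T = tensor_module[OF LL L]
  note b = pure_tensor_bilinear[OF L L] pure_tensor_bilinear[OF LL L]
  let ?\<beta> = "\<lambda>z x y. pure_tensor R (tensor R L L) L (pure_tensor R L L y z) x"
  have \<beta>: "?\<beta> z \<in> bilinear_maps R L L (tensor R (tensor R L L) L)" if "z \<in> carrier L" for z
    using that b by (auto simp: bilinear_maps_def module_hom_def Pi_iff)
  have "(\<lambda>z. ?\<beta> z x y) \<in> module_hom R L (tensor R (tensor R L L) L)"
    if "x \<in> carrier L" "y \<in> carrier L" for x y
    using that b by (auto simp: bilinear_maps_def module_hom_def Pi_iff)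
  note * = LL L T tensor_lift_bilinear(2)[OF L L L T \<beta> this]
  show "tensor_cycle R L \<in>
      module_hom R (tensor R (tensor R L L) L) (tensor R (tensor R L L) L)"
    unfolding tensor_cycle_def by (rule tensor_lift_hom[OF *])
  show "tensor_cycle R L (pure_tensor R (tensor R L L) L (pure_tensor R L L x y) z) =
      pure_tensor R (tensor R L L) L (pure_tensor R L L y z) x"
    if "x \<in> carrier L" "y \<in> carrier L" "z \<in> carrier L" for x y z
  proof -
    have "pure_tensor R L L x y \<in> carrier (tensor R L L)"
      using b that by (auto simp: bilinear_maps_def module_hom_def)
    then show ?thesis
      unfolding tensor_cycle_def
      using that by (simp add: tensor_lift_pure[OF *] tensor_lift_pure[OF L L T \<beta>])
  qed
qed


section \<open>Post-Hom-Lie coalgebras and their comodules\<close>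

text \<open>
  For \<open>f : L \<rightarrow> L \<otimes> L\<close> and \<open>g : M \<rightarrow> M\<close>, the map \<open>f \<otimes> g : L \<otimes> M \<rightarrow> L \<otimes> L \<otimes> M\<close>.
\<close>

definition tensor_left ::
    "('r, 'm) ring_scheme \<Rightarrow> ('r, 'a, 'm1) module_scheme \<Rightarrow> ('r, 'b, 'm2) module_scheme
      \<Rightarrow> ('a \<Rightarrow> ('a \<times> 'a \<Rightarrow> 'r) set) \<Rightarrow> ('b \<Rightarrow> 'b)
      \<Rightarrow> ('a \<times> 'b \<Rightarrow> 'r) set \<Rightarrow> (('a \<times> 'a \<Rightarrow> 'r) set \<times> 'b \<Rightarrow> 'r) set"
  where "tensor_left F L M f g = tensor_map F L M (tensor F L L) M f g"

text \<open>
  For \<open>f : L \<rightarrow> L\<close> and \<open>g : M \<rightarrow> L \<otimes> M\<close>, the map \<open>f \<otimes> g : L \<otimes> M \<rightarrow> L \<otimes> L \<otimes> M\<close>.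
\<close>

definition tensor_right ::
    "('r, 'm) ring_scheme \<Rightarrow> ('r, 'a, 'm1) module_scheme \<Rightarrow> ('r, 'b, 'm2) module_scheme
      \<Rightarrow> ('a \<Rightarrow> 'a) \<Rightarrow> ('b \<Rightarrow> ('a \<times> 'b \<Rightarrow> 'r) set)
      \<Rightarrow> ('a \<times> 'b \<Rightarrow> 'r) set \<Rightarrow> (('a \<times> 'a \<Rightarrow> 'r) set \<times> 'b \<Rightarrow> 'r) set"
  where "tensor_right F L M f g =
    tensor_assoc F L L M \<circ> tensor_map F L M L (tensor F L M) f g"

text \<open>The map \<open>\<tau> \<otimes> Id\<close> on \<open>L \<otimes> L \<otimes> M\<close>.\<close>

definition swap_left ::
    "('r, 'm) ring_scheme \<Rightarrow> ('r, 'a, 'm1) module_scheme \<Rightarrow> ('r, 'b, 'm2) module_scheme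
      \<Rightarrow> (('a \<times> 'a \<Rightarrow> 'r) set \<times> 'b \<Rightarrow> 'r) set \<Rightarrow> (('a \<times> 'a \<Rightarrow> 'r) set \<times> 'b \<Rightarrow> 'r) set"
  where "swap_left F L M =
    tensor_map F (tensor F L L) M (tensor F L L) M (tensor_swap F L L) id"

locale hom_coalgebra_data =
  fixes F :: "('f, 'mf) ring_scheme"
    and L :: "('f, 'l, 'ml) module_scheme"
    and \<gamma> \<Delta> :: "'l \<Rightarrow> ('l \<times> 'l \<Rightarrow> 'f) set"
    and \<alpha> :: "'l \<Rightarrow> 'l"
  assumes \<gamma>_linear: "linear_map F L (tensor F L L) \<gamma>"
    and \<Delta>_linear: "linear_map F L (tensor F L L) \<Delta>"
    and \<alpha>_linear: "linear_map F L L \<alpha>"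
begin

abbreviation "LL \<equiv> tensor F L L"
abbreviation "LLL \<equiv> tensor F LL L"
abbreviation "\<xi> \<equiv> tensor_cycle F L"
abbreviation "\<tau>_Id \<equiv> swap_left F L L"

end

locale post_hom_lie_coalgebra = hom_coalgebra_data +
  assumes skew: "x \<in> carrier L \<Longrightarrow> \<gamma> x = \<ominus>\<^bsub>LL\<^esub> tensor_swap F L L (\<gamma> x)"
    and \<gamma>_\<alpha>: "x \<in> carrier L \<Longrightarrow> \<gamma> (\<alpha> x) = tensor_map F L L L L \<alpha> \<alpha> (\<gamma> x)"
    and hom_jacobi: "x \<in> carrier L \<Longrightarrow>
      tensor_right F L L \<alpha> \<gamma> (\<gamma> x)
      \<oplus>\<^bsub>LLL\<^esub> \<xi> (tensor_right F L L \<alpha> \<gamma> (\<gamma> x))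
      \<oplus>\<^bsub>LLL\<^esub> \<xi> (\<xi> (tensor_right F L L \<alpha> \<gamma> (\<gamma> x))) = \<zero>\<^bsub>LLL\<^esub>"
    and post_lie_1: "x \<in> carrier L \<Longrightarrow>
      tensor_right F L L \<alpha> \<gamma> (\<Delta> x)
      \<ominus>\<^bsub>LLL\<^esub> tensor_left F L L \<Delta> \<alpha> (\<gamma> x)
      \<ominus>\<^bsub>LLL\<^esub> \<tau>_Id (tensor_right F L L \<alpha> \<Delta> (\<gamma> x)) = \<zero>\<^bsub>LLL\<^esub>"
    and post_lie_2: "x \<in> carrier L \<Longrightarrow>
      tensor_left F L L \<Delta> \<alpha> (\<Delta> x)
      \<ominus>\<^bsub>LLL\<^esub> tensor_right F L L \<alpha> \<Delta> (\<Delta> x)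
      \<ominus>\<^bsub>LLL\<^esub> \<tau>_Id (tensor_left F L L \<Delta> \<alpha> (\<Delta> x))
      \<oplus>\<^bsub>LLL\<^esub> \<tau>_Id (tensor_right F L L \<alpha> \<Delta> (\<Delta> x))
      \<oplus>\<^bsub>LLL\<^esub> tensor_left F L L \<gamma> \<alpha> (\<Delta> x) = \<zero>\<^bsub>LLL\<^esub>"

text \<open>
  A comodule is given by its own four axioms, for any linear \<open>\<gamma>\<close>, \<open>\<Delta>\<close>, \<open>\<alpha>\<close>: that \<open>(L, \<gamma>, \<Delta>, \<alpha>)\<close> is a
  post-Hom-Lie coalgebra is not part of the predicate and has to be assumed separately where it is
  meant. The axioms of a post-Hom-Lie coalgebra do not make \<open>\<Delta>\<close> commute with \<open>\<alpha>\<close>, and without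
  that \<open>(L, \<gamma> \<circ> \<alpha>^n, \<Delta> \<circ> \<alpha>^n, \<alpha>^(n+1))\<close> need not satisfy \<open>post_lie_2\<close> again: take \<open>\<gamma> = 0\<close> on a
  basis \<open>e\<^sub>0, e\<^sub>1\<close>, with \<open>\<Delta> e\<^sub>0 = 0\<close>, \<open>\<Delta> e\<^sub>1 = e\<^sub>0 \<otimes> e\<^sub>0\<close>, \<open>\<alpha> e\<^sub>0 = e\<^sub>1\<close>, \<open>\<alpha> e\<^sub>1 = e\<^sub>0 + e\<^sub>1\<close> and \<open>n = 1\<close>.
\<close>

locale post_hom_lie_comodule = hom_coalgebra_data F L \<gamma> \<Delta> \<alpha>
  for F :: "('f, 'mf) ring_scheme"
    and L :: "('f, 'l, 'ml) module_scheme"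
    and \<gamma> \<Delta> \<alpha> +
  fixes M :: "('f, 'v, 'mv) module_scheme"
    and \<Delta>\<^sub>d \<Delta>\<^sub>b :: "'v \<Rightarrow> ('l \<times> 'v \<Rightarrow> 'f) set"
    and \<alpha>\<^sub>M :: "'v \<Rightarrow> 'v"
  assumes \<alpha>\<^sub>M_linear: "linear_map F M M \<alpha>\<^sub>M"
    and \<Delta>\<^sub>d_linear: "linear_map F M (tensor F L M) \<Delta>\<^sub>d"
    and \<Delta>\<^sub>b_linear: "linear_map F M (tensor F L M) \<Delta>\<^sub>b"
    and \<Delta>\<^sub>d_\<alpha>: "m \<in> carrier M \<Longrightarrow> \<Delta>\<^sub>d (\<alpha>\<^sub>M m) = tensor_map F L M L M \<alpha> \<alpha>\<^sub>M (\<Delta>\<^sub>d m)"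
    and \<Delta>\<^sub>b_\<alpha>: "m \<in> carrier M \<Longrightarrow> \<Delta>\<^sub>b (\<alpha>\<^sub>M m) = tensor_map F L M L M \<alpha> \<alpha>\<^sub>M (\<Delta>\<^sub>b m)"
    and comodule_1: "m \<in> carrier M \<Longrightarrow>
      tensor_left F L M \<gamma> \<alpha>\<^sub>M (\<Delta>\<^sub>d m) =
      tensor_right F L M \<alpha> \<Delta>\<^sub>d (\<Delta>\<^sub>d m)
      \<ominus>\<^bsub>tensor F LL M\<^esub> swap_left F L M (tensor_right F L M \<alpha> \<Delta>\<^sub>d (\<Delta>\<^sub>d m))"
    and comodule_2: "m \<in> carrier M \<Longrightarrow>
      tensor_left F L M \<Delta> \<alpha>\<^sub>M (\<Delta>\<^sub>d m) =
      tensor_right F L M \<alpha> \<Delta>\<^sub>d (\<Delta>\<^sub>b m)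
      \<ominus>\<^bsub>tensor F LL M\<^esub> swap_left F L M (tensor_right F L M \<alpha> \<Delta>\<^sub>b (\<Delta>\<^sub>d m))"
    and comodule_3: "m \<in> carrier M \<Longrightarrow>
      tensor_left F L M \<gamma> \<alpha>\<^sub>M (\<Delta>\<^sub>b m) =
      (tensor_right F L M \<alpha> \<Delta>\<^sub>b (\<Delta>\<^sub>b m)
       \<ominus>\<^bsub>tensor F LL M\<^esub> swap_left F L M (tensor_right F L M \<alpha> \<Delta>\<^sub>b (\<Delta>\<^sub>b m)))
      \<oplus>\<^bsub>tensor F LL M\<^esub>
      (swap_left F L M (tensor_left F L M \<Delta> \<alpha>\<^sub>M (\<Delta>\<^sub>b m))
       \<ominus>\<^bsub>tensor F LL M\<^esub> tensor_left F L M \<Delta> \<alpha>\<^sub>M (\<Delta>\<^sub>b m))"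

end

theory Submission
  imports Defs
begin

text \<open>
  Since \<open>(\<alpha> \<otimes> \<alpha>\<^sub>M)^n \<circ> \<Delta>\<^sub>d = \<Delta>\<^sub>d \<circ> \<alpha>\<^sub>M^n\<close>, and likewise for \<open>\<Delta>\<^sub>b\<close>, each term of an axiom for the maps
  twisted by \<open>n\<close>-th powers equals the corresponding term for the original maps precomposed with
  \<open>\<alpha>\<^sub>M^(2n)\<close>. So the twisted compatibility axiom at \<open>m\<close> is the original one at \<open>\<alpha>\<^sub>M^(2n) m\<close>, for
  any \<open>n\<close>.
\<close>

lemma module_hom_comp:
  assumes "f \<in> module_hom R A B" "g \<in> module_hom R B C"
  shows "g \<circ> f \<in> module_hom R A C"
  using assms by (auto simp: module_hom_def Pi_iff)

lemma module_hom_id: "module R A \<Longrightarrow> id \<in> module_hom R A A"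
  by (auto simp: module_hom_def)

lemma module_hom_funpow:
  assumes "module R A" "f \<in> module_hom R A A"
  shows "f ^^ n \<in> module_hom R A A"
proof (induction n)
  case 0
  show ?case using module_hom_id[OF assms(1)] by (simp add: id_def)
next
  case (Suc n)
  show ?case unfolding funpow.simps by (rule module_hom_comp[OF Suc assms(2)])
qed

lemma module_hom_closed: "f \<in> module_hom R A B \<Longrightarrow> x \<in> carrier A \<Longrightarrow> f x \<in> carrier B"
  by (auto simp: module_hom_def)

text \<open>Separates the vector space conditions, which twisting leaves alone, from membership in
  \<open>module_hom\<close>, the form in which the facts on tensor products are stated.\<close>

lemma linear_map_iff:
  "linear_map F V W f \<longleftrightarrow> vectorspace F V \<and> vectorspace F W \<and> f \<in> module_hom F V W"
  by (auto simp: linear_map_def mod_hom_def mod_hom_axioms_def vectorspace_def)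

text \<open>Homomorphisms out of a tensor product agree once they agree on pure tensors. This
  supplies the case n = 0 of \<open>tensor_map_funpow\<close>.\<close>

lemma tensor_map_id:
  assumes "module R A" "module R B" "u \<in> carrier (tensor R A B)"
  shows "tensor_map R A B A B id id u = u"
proof -
  note ids = module_hom_id[OF assms(1)] module_hom_id[OF assms(2)]
  have "tensor_map R A B A B id id u = id u"
    by (rule tensor_hom_eqI[OF assms(1,2) tensor_module[OF assms(1,2)]
          tensor_map_hom[OF assms(1,2) assms(1,2) ids] module_hom_id[OF tensor_module[OF assms(1,2)]]
          _ assms(3)])
      (simp add: tensor_map_pure[OF assms(1,2) assms(1,2) ids])
  then show ?thesis by simp
qed

text \<open>Functoriality of the tensor product: both sides are homomorphisms in \<open>u\<close>
  that send a pure tensor of \<open>a\<close> and \<open>b\<close> to that of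
  \<open>f' (f a)\<close> and \<open>g' (g b)\<close>. Every factorization of a twisted map below
  comes from this.\<close>

lemma tensor_map_comp:
  assumes A: "module R A" and B: "module R B" and A': "module R A'" and B': "module R B'"
    and C: "module R C" and D: "module R D"
    and f: "f \<in> module_hom R A A'" and g: "g \<in> module_hom R B B'"
    and f': "f' \<in> module_hom R A' C" and g': "g' \<in> module_hom R B' D"
    and u: "u \<in> carrier (tensor R A B)"
  shows "tensor_map R A B C D (f' \<circ> f) (g' \<circ> g) u =
    tensor_map R A' B' C D f' g' (tensor_map R A B A' B' f g u)"
proof -
  note fg = A B A' B' f g and fg' = A' B' C D f' g'
  note ff = A B C D module_hom_comp[OF f f'] module_hom_comp[OF g g']
  have "tensor_map R A B C D (f' \<circ> f) (g' \<circ> g) u =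
      (tensor_map R A' B' C D f' g' \<circ> tensor_map R A B A' B' f g) u"
    by (rule tensor_hom_eqI[OF A B tensor_module[OF C D] tensor_map_hom[OF ff]
          module_hom_comp[OF tensor_map_hom[OF fg] tensor_map_hom[OF fg']] _ u])
      (simp add: tensor_map_pure[OF ff] tensor_map_pure[OF fg] tensor_map_pure[OF fg']
        module_hom_closed[OF f] module_hom_closed[OF g])
  then show ?thesis by simp
qed

text \<open>Induction on \<open>n\<close>: functoriality splits off one factor \<alpha> \<otimes>
  \<beta>, and \<open>comm\<close> moves it through \<delta>. With \<delta> arbitrary, one proof
  serves both coactions.\<close>

lemma tensor_map_funpow:
  assumes L: "module R L" and M: "module R M"
    and \<alpha>: "\<alpha> \<in> module_hom R L L" and \<beta>: "\<beta> \<in> module_hom R M M"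
    and \<delta>: "\<delta> \<in> module_hom R M (tensor R L M)"
    and comm: "\<And>m. m \<in> carrier M \<Longrightarrow> \<delta> (\<beta> m) = tensor_map R L M L M \<alpha> \<beta> (\<delta> m)"
    and m: "m \<in> carrier M"
  shows "tensor_map R L M L M (\<alpha> ^^ n) (\<beta> ^^ n) (\<delta> m) = \<delta> ((\<beta> ^^ n) m)"
proof (induction n)
  case 0
  show ?case
    using tensor_map_id[OF L M module_hom_closed[OF \<delta> m]] by (simp add: id_def)
next
  case (Suc n)
  have "(\<beta> ^^ n) m \<in> carrier M"
    using module_hom_closed[OF module_hom_funpow[OF M \<beta>] m] .
  \<comment> \<open>\<open>comm\<close> is applied at the point \<open>(\<beta> ^^ n) m\<close>, and
    the induction hypothesis rewrites the value of \<delta> there.\<close>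
  then have "\<delta> ((\<beta> ^^ Suc n) m) =
      tensor_map R L M L M \<alpha> \<beta> (tensor_map R L M L M (\<alpha> ^^ n) (\<beta> ^^ n) (\<delta> m))"
    by (simp add: comm Suc)
  then show ?case
    unfolding funpow.simps(2)
    by (simp only: tensor_map_comp[OF L M L M L M module_hom_funpow[OF L \<alpha>]
        module_hom_funpow[OF M \<beta>] \<alpha> \<beta> module_hom_closed[OF \<delta> m]])
qed

context post_hom_lie_comodule
begin

lemma L: "module F L" and M: "module F M"
  and \<gamma>_hom: "\<gamma> \<in> module_hom F L LL" and \<Delta>_hom: "\<Delta> \<in> module_hom F L LL"
  and \<alpha>_hom: "\<alpha> \<in> module_hom F L L" and \<alpha>\<^sub>M_hom: "\<alpha>\<^sub>M \<in> module_hom F M M"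
  and \<Delta>\<^sub>d_hom: "\<Delta>\<^sub>d \<in> module_hom F M (tensor F L M)"
  and \<Delta>\<^sub>b_hom: "\<Delta>\<^sub>b \<in> module_hom F M (tensor F L M)"
  using \<gamma>_linear \<Delta>_linear \<alpha>_linear \<alpha>\<^sub>M_linear \<Delta>\<^sub>d_linear \<Delta>\<^sub>b_linear
  by (auto simp: linear_map_iff vectorspace_def)

lemmas \<alpha>_pow_hom = module_hom_funpow[OF L \<alpha>_hom]
lemmas \<alpha>\<^sub>M_pow_hom = module_hom_funpow[OF M \<alpha>\<^sub>M_hom]

lemmas \<Delta>\<^sub>d_pow = tensor_map_funpow[OF L M \<alpha>_hom \<alpha>\<^sub>M_hom \<Delta>\<^sub>d_hom \<Delta>\<^sub>d_\<alpha>]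
lemmas \<Delta>\<^sub>b_pow = tensor_map_funpow[OF L M \<alpha>_hom \<alpha>\<^sub>M_hom \<Delta>\<^sub>b_hom \<Delta>\<^sub>b_\<alpha>]

text \<open>The extra power in \<open>Suc n\<close> is what remains beside \<open>f\<close>: since
  \<open>\<alpha>\<^sub>M ^^ Suc n\<close> is
  \<open>\<alpha>\<^sub>M \<circ> \<alpha>\<^sub>M ^^ n\<close>, functoriality lets the n-th powers
  act first on both factors.\<close>

lemma tensor_left_twist:
  assumes f: "f \<in> module_hom F L LL" and u: "u \<in> carrier (tensor F L M)"
  shows "tensor_left F L M (f \<circ> \<alpha> ^^ n) (\<alpha>\<^sub>M ^^ Suc n) u =
    tensor_left F L M f \<alpha>\<^sub>M (tensor_map F L M L M (\<alpha> ^^ n) (\<alpha>\<^sub>M ^^ n) u)"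
  unfolding tensor_left_def
  using tensor_map_comp[OF L M L M tensor_module[OF L L] M \<alpha>_pow_hom \<alpha>\<^sub>M_pow_hom f \<alpha>\<^sub>M_hom u]
  by simp

text \<open>Mirror image of the previous factorization, with the extra power now on \<alpha>. The
  reassociation is applied last, so it is the same on both sides. Both lemmas expose the same inner
  map, which can then be absorbed by a coaction.\<close>

lemma tensor_right_twist:
  assumes g: "g \<in> module_hom F M (tensor F L M)" and u: "u \<in> carrier (tensor F L M)"
  shows "tensor_right F L M (\<alpha> ^^ Suc n) (g \<circ> \<alpha>\<^sub>M ^^ n) u =
    tensor_right F L M \<alpha> g (tensor_map F L M L M (\<alpha> ^^ n) (\<alpha>\<^sub>M ^^ n) u)"
  unfolding tensor_right_def
  using tensor_map_comp[OF L M L M L tensor_module[OF L M] \<alpha>_pow_hom \<alpha>\<^sub>M_pow_hom \<alpha>_hom g u]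
  by simp

theorem twist_comodule:
  "post_hom_lie_comodule F L (\<gamma> \<circ> \<alpha> ^^ n) (\<Delta> \<circ> \<alpha> ^^ n) (\<alpha> ^^ Suc n)
    M (\<Delta>\<^sub>d \<circ> \<alpha>\<^sub>M ^^ n) (\<Delta>\<^sub>b \<circ> \<alpha>\<^sub>M ^^ n) (\<alpha>\<^sub>M ^^ Suc n)"
proof -
  have vs: "vectorspace F L" "vectorspace F M" "vectorspace F LL" "vectorspace F (tensor F L M)"
    using \<gamma>_linear \<Delta>\<^sub>d_linear by (auto simp: linear_map_iff)
  have closed: "(\<alpha>\<^sub>M ^^ j) m \<in> carrier M" if "m \<in> carrier M" for j m
    using module_hom_closed[OF \<alpha>\<^sub>M_pow_hom that] .
  show ?thesis
  proof (intro post_hom_lie_comodule.intro hom_coalgebra_data.intro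
      post_hom_lie_comodule_axioms.intro)
    show "linear_map F L LL (\<gamma> \<circ> \<alpha> ^^ n)" "linear_map F L LL (\<Delta> \<circ> \<alpha> ^^ n)"
      "linear_map F L L (\<alpha> ^^ Suc n)" "linear_map F M M (\<alpha>\<^sub>M ^^ Suc n)"
      "linear_map F M (tensor F L M) (\<Delta>\<^sub>d \<circ> \<alpha>\<^sub>M ^^ n)"
      "linear_map F M (tensor F L M) (\<Delta>\<^sub>b \<circ> \<alpha>\<^sub>M ^^ n)"
      unfolding linear_map_iff
      by (intro conjI vs \<alpha>_pow_hom \<alpha>\<^sub>M_pow_hom module_hom_comp[OF \<alpha>_pow_hom \<gamma>_hom]
        module_hom_comp[OF \<alpha>_pow_hom \<Delta>_hom] module_hom_comp[OF \<alpha>\<^sub>M_pow_hom \<Delta>\<^sub>d_hom]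
        module_hom_comp[OF \<alpha>\<^sub>M_pow_hom \<Delta>\<^sub>b_hom])+
  next
    fix m assume m: "m \<in> carrier M"
    \<comment> \<open>Reordering the powers puts \<open>Suc n\<close> outermost, so that
      \<open>tensor_map_funpow\<close> applies with exponent \<open>Suc n\<close> at the point
      \<open>(\<alpha>\<^sub>M ^^ n) m\<close>.\<close>
    have comm: "(\<alpha>\<^sub>M ^^ n) ((\<alpha>\<^sub>M ^^ Suc n) m) = (\<alpha>\<^sub>M ^^ Suc n) ((\<alpha>\<^sub>M ^^ n) m)"
      by (metis add.commute comp_apply funpow_add)
    show "(\<Delta>\<^sub>d \<circ> \<alpha>\<^sub>M ^^ n) ((\<alpha>\<^sub>M ^^ Suc n) m) =
        tensor_map F L M L M (\<alpha> ^^ Suc n) (\<alpha>\<^sub>M ^^ Suc n) ((\<Delta>\<^sub>d \<circ> \<alpha>\<^sub>M ^^ n) m)"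
      unfolding comp_apply comm by (rule \<Delta>\<^sub>d_pow[OF _ closed[OF m], symmetric])
    show "(\<Delta>\<^sub>b \<circ> \<alpha>\<^sub>M ^^ n) ((\<alpha>\<^sub>M ^^ Suc n) m) =
        tensor_map F L M L M (\<alpha> ^^ Suc n) (\<alpha>\<^sub>M ^^ Suc n) ((\<Delta>\<^sub>b \<circ> \<alpha>\<^sub>M ^^ n) m)"
      unfolding comp_apply comm by (rule \<Delta>\<^sub>b_pow[OF _ closed[OF m], symmetric])
    \<comment> \<open>The original axioms will be used at this point: one n-th power sits inside the
      twisted coaction, the other comes from moving the exposed inner map through that
      coaction.\<close>
    note m' = closed[OF closed[OF m, of n], of n]
    have d: "tensor_map F L M L M (\<alpha> ^^ n) (\<alpha>\<^sub>M ^^ n) ((\<Delta>\<^sub>d \<circ> \<alpha>\<^sub>M ^^ n) m) =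
        \<Delta>\<^sub>d ((\<alpha>\<^sub>M ^^ n) ((\<alpha>\<^sub>M ^^ n) m))"
      using \<Delta>\<^sub>d_pow[OF _ closed[OF m]] by simp
    have b: "tensor_map F L M L M (\<alpha> ^^ n) (\<alpha>\<^sub>M ^^ n) ((\<Delta>\<^sub>b \<circ> \<alpha>\<^sub>M ^^ n) m) =
        \<Delta>\<^sub>b ((\<alpha>\<^sub>M ^^ n) ((\<alpha>\<^sub>M ^^ n) m))"
      using \<Delta>\<^sub>b_pow[OF _ closed[OF m]] by simp
    have c: "(\<Delta>\<^sub>d \<circ> \<alpha>\<^sub>M ^^ n) m \<in> carrier (tensor F L M)"
        "(\<Delta>\<^sub>b \<circ> \<alpha>\<^sub>M ^^ n) m \<in> carrier (tensor F L M)"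
      using module_hom_closed[OF \<Delta>\<^sub>d_hom closed[OF m]]
        module_hom_closed[OF \<Delta>\<^sub>b_hom closed[OF m]] by simp_all
    \<comment> \<open>Covers every pairing of an outer map with an inner coaction. The rewriting
      takes place below \<open>swap_left\<close>, which involves neither \<alpha> nor
      \<open>\<alpha>\<^sub>M\<close> and stays in place.\<close>
    note twist = tensor_left_twist[OF \<gamma>_hom c(1)] tensor_left_twist[OF \<gamma>_hom c(2)]
      tensor_left_twist[OF \<Delta>_hom c(1)] tensor_left_twist[OF \<Delta>_hom c(2)]
      tensor_right_twist[OF \<Delta>\<^sub>d_hom c(1)] tensor_right_twist[OF \<Delta>\<^sub>d_hom c(2)]
      tensor_right_twist[OF \<Delta>\<^sub>b_hom c(1)] tensor_right_twist[OF \<Delta>\<^sub>b_hom c(2)]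
    show "tensor_left F L M (\<gamma> \<circ> \<alpha> ^^ n) (\<alpha>\<^sub>M ^^ Suc n) ((\<Delta>\<^sub>d \<circ> \<alpha>\<^sub>M ^^ n) m) =
      tensor_right F L M (\<alpha> ^^ Suc n) (\<Delta>\<^sub>d \<circ> \<alpha>\<^sub>M ^^ n) ((\<Delta>\<^sub>d \<circ> \<alpha>\<^sub>M ^^ n) m)
      \<ominus>\<^bsub>tensor F LL M\<^esub> swap_left F L M
        (tensor_right F L M (\<alpha> ^^ Suc n) (\<Delta>\<^sub>d \<circ> \<alpha>\<^sub>M ^^ n) ((\<Delta>\<^sub>d \<circ> \<alpha>\<^sub>M ^^ n) m))"
      unfolding twist d by (rule comodule_1[OF m'])
    show "tensor_left F L M (\<Delta> \<circ> \<alpha> ^^ n) (\<alpha>\<^sub>M ^^ Suc n) ((\<Delta>\<^sub>d \<circ> \<alpha>\<^sub>M ^^ n) m) =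
      tensor_right F L M (\<alpha> ^^ Suc n) (\<Delta>\<^sub>d \<circ> \<alpha>\<^sub>M ^^ n) ((\<Delta>\<^sub>b \<circ> \<alpha>\<^sub>M ^^ n) m)
      \<ominus>\<^bsub>tensor F LL M\<^esub> swap_left F L M
        (tensor_right F L M (\<alpha> ^^ Suc n) (\<Delta>\<^sub>b \<circ> \<alpha>\<^sub>M ^^ n) ((\<Delta>\<^sub>d \<circ> \<alpha>\<^sub>M ^^ n) m))"
      unfolding twist d b by (rule comodule_2[OF m'])
    show "tensor_left F L M (\<gamma> \<circ> \<alpha> ^^ n) (\<alpha>\<^sub>M ^^ Suc n) ((\<Delta>\<^sub>b \<circ> \<alpha>\<^sub>M ^^ n) m) =
      (tensor_right F L M (\<alpha> ^^ Suc n) (\<Delta>\<^sub>b \<circ> \<alpha>\<^sub>M ^^ n) ((\<Delta>\<^sub>b \<circ> \<alpha>\<^sub>M ^^ n) m)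
       \<ominus>\<^bsub>tensor F LL M\<^esub> swap_left F L M
        (tensor_right F L M (\<alpha> ^^ Suc n) (\<Delta>\<^sub>b \<circ> \<alpha>\<^sub>M ^^ n) ((\<Delta>\<^sub>b \<circ> \<alpha>\<^sub>M ^^ n) m)))
      \<oplus>\<^bsub>tensor F LL M\<^esub>
      (swap_left F L M (tensor_left F L M (\<Delta> \<circ> \<alpha> ^^ n) (\<alpha>\<^sub>M ^^ Suc n) ((\<Delta>\<^sub>b \<circ> \<alpha>\<^sub>M ^^ n) m))
       \<ominus>\<^bsub>tensor F LL M\<^esub>
        tensor_left F L M (\<Delta> \<circ> \<alpha> ^^ n) (\<alpha>\<^sub>M ^^ Suc n) ((\<Delta>\<^sub>b \<circ> \<alpha>\<^sub>M ^^ n) m))"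
      unfolding twist b by (rule comodule_3[OF m'])
  qed
qed

end

theorem theorem5p9:
  fixes F :: "('f, 'mf) ring_scheme"
    and L :: "('f, 'l, 'ml) module_scheme"
    and M :: "('f, 'v, 'mv) module_scheme"
    and \<gamma> \<Delta> :: "'l \<Rightarrow> ('l \<times> 'l \<Rightarrow> 'f) set"
    and \<alpha> :: "'l \<Rightarrow> 'l"
    and \<Delta>\<^sub>d \<Delta>\<^sub>b :: "'v \<Rightarrow> ('l \<times> 'v \<Rightarrow> 'f) set"
    and \<alpha>\<^sub>M :: "'v \<Rightarrow> 'v"
    and k :: nat
  assumes "field F" and "\<And>n::nat. n > 0 \<Longrightarrow> [n] \<cdot>\<^bsub>F\<^esub> \<one>\<^bsub>F\<^esub> \<noteq> \<zero>\<^bsub>F\<^esub>"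
    and "post_hom_lie_coalgebra F L \<gamma> \<Delta> \<alpha>"
    and "post_hom_lie_comodule F L \<gamma> \<Delta> \<alpha> M \<Delta>\<^sub>d \<Delta>\<^sub>b \<alpha>\<^sub>M"
  shows "post_hom_lie_comodule F L
      (\<gamma> \<circ> \<alpha> ^^ (2 ^ k - 1)) (\<Delta> \<circ> \<alpha> ^^ (2 ^ k - 1)) (\<alpha> ^^ (2 ^ k))
      M (\<Delta>\<^sub>d \<circ> \<alpha>\<^sub>M ^^ (2 ^ k - 1)) (\<Delta>\<^sub>b \<circ> \<alpha>\<^sub>M ^^ (2 ^ k - 1)) (\<alpha>\<^sub>M ^^ (2 ^ k))"
proof -
  \<comment> \<open>Subtraction on \<open>nat\<close> does not truncate here because
    \<open>2 ^ k\<close> is at least 1. For k = 0 the exponent n is 0 and the twist is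
    trivial.\<close>
  have "Suc (2 ^ k - 1) = (2 ^ k :: nat)" by simp
  then show ?thesis
    using post_hom_lie_comodule.twist_comodule[OF assms(4), of "2 ^ k - 1"] by simp
qed

end
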